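(* Let $(S,\top_S,\cdot)$ be a refined locality semigroup. Let $0\notin S$ and let $S^0:=S\cup\{0\}$. Define a binary operation $\ast:S^0\times S^0\to S^0$ by $$x\ast y:=\begin{cases}x\cdot y, & (x,y)\in\top_S,\\ 0, & (x,y)\notin\top_S.\end{cases}$$ Then $(S^0,\ast)$ is a semigroup with zero (the zero element being $0$).
   Context: A locality set is a pair $(S,\top)$ with $S$ a set and $\top\subseteq S\times S$. A refined locality semigroup is a locality set $(S,\top)$ with a partial binary operation $\top\to S$, $(a,b)\mapsto a\cdot b=ab$, such that for all $a,b,c\in S$: (i) if $(a,b)\in\top$, then $(b,c)\in\top$ if and only if $(ab,c)\in\top$; (ii) if $(b,c)\in\top$, then $(a,b)\in\top$ if and only if $(a,bc)\in\top$; (iii) if $(a,b),(b,c)\in\top$, then $(ab)c=a(bc)$. *)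

theory Defs
  imports Main
begin

locale locality_set =
  fixes S :: "'a set" and T :: "('a \<times> 'a) set"
  assumes T_subset: "T \<subseteq> S \<times> S"

text \<open>
  The partial operation from \<open>T\<close> to \<open>S\<close> is encoded by a total function \<open>f\<close> of which
  only the values at pairs in \<open>T\<close> matter; no assumption is made about \<open>f\<close> elsewhere.
\<close>

locale refined_locality_semigroup = locality_set S T
  for S :: "'a set" and T :: "('a \<times> 'a) set" +
  fixes f :: "'a \<Rightarrow> 'a \<Rightarrow> 'a"
  assumes closed: "(a, b) \<in> T \<Longrightarrow> f a b \<in> S"
    and locality_left:
      "\<lbrakk>a \<in> S; b \<in> S; c \<in> S; (a, b) \<in> T\<rbrakk> \<Longrightarrow> (b, c) \<in> T \<longleftrightarrow> (f a b, c) \<in> T"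
    and locality_right:
      "\<lbrakk>a \<in> S; b \<in> S; c \<in> S; (b, c) \<in> T\<rbrakk> \<Longrightarrow> (a, b) \<in> T \<longleftrightarrow> (a, f b c) \<in> T"
    and locality_assoc:
      "\<lbrakk>a \<in> S; b \<in> S; c \<in> S; (a, b) \<in> T; (b, c) \<in> T\<rbrakk> \<Longrightarrow> f (f a b) c = f a (f b c)"

text \<open>
  Semigroups on a carrier set; the locale \<^locale>\<open>semigroup\<close> of the library always has
  a whole type as its carrier.
\<close>

locale semigroup_on =
  fixes A :: "'a set" and g :: "'a \<Rightarrow> 'a \<Rightarrow> 'a"
  assumes closed: "\<lbrakk>x \<in> A; y \<in> A\<rbrakk> \<Longrightarrow> g x y \<in> A"
    and assoc: "\<lbrakk>x \<in> A; y \<in> A; z \<in> A\<rbrakk> \<Longrightarrow> g (g x y) z = g x (g y z)"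

locale semigroup_with_zero_on = semigroup_on A g
  for A :: "'a set" and g :: "'a \<Rightarrow> 'a \<Rightarrow> 'a" +
  fixes z :: 'a
  assumes zero_in: "z \<in> A"
    and zero_left: "x \<in> A \<Longrightarrow> g z x = z"
    and zero_right: "x \<in> A \<Longrightarrow> g x z = z"

definition zero_extension :: "('a \<times> 'a) set \<Rightarrow> ('a \<Rightarrow> 'a \<Rightarrow> 'a) \<Rightarrow> 'a \<Rightarrow> 'a \<Rightarrow> 'a \<Rightarrow> 'a" where
  "zero_extension T f z x y = (if (x, y) \<in> T then f x y else z)"

end

theory Submission
  imports Defs
begin

text \<open>
  Write \<open>*\<close> for the extended operation. Since \<open>z\<close> lies outside \<open>S\<close>, it occurs in no pair of \<open>T\<close>,
  so every product with factor \<open>z\<close> is \<open>z\<close>. For associativity, the two refined locality conditions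
  say that both \<open>(a * b) * c\<close> and \<open>a * (b * c)\<close> are genuine products exactly when \<open>(a, b)\<close> and
  \<open>(b, c)\<close> are both in \<open>T\<close>, in which case partial associativity identifies them; otherwise both
  collapse to \<open>z\<close>. The equivalences, rather than mere implications, are what makes this work: if
  \<open>(a, b)\<close> is in \<open>T\<close> and \<open>(b, c)\<close> is not, the right-hand product is \<open>z\<close>, and the left-hand one
  is \<open>z\<close> because \<open>(a b, c)\<close> cannot be in \<open>T\<close> either.
\<close>

context refined_locality_semigroup
begin

lemma zero_extension_zero:
  assumes "z \<notin> S"
  shows "zero_extension T f z z x = z" and "zero_extension T f z x z = z"
  using assms T_subset by (auto simp: zero_extension_def)

text \<open>
  The left bracketing has a normal form that depends only on membership of \<open>(a, b)\<close> and \<open>(b, c)\<close>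
  in \<open>T\<close>; the next lemma gives the same condition for the right bracketing.
\<close>

lemma zero_extension_left_bracketing:
  assumes "z \<notin> S" and "a \<in> S" "b \<in> S" "c \<in> S"
  shows "zero_extension T f z (zero_extension T f z a b) c =
    (if (a, b) \<in> T \<and> (b, c) \<in> T then f (f a b) c else z)"
  using assms locality_left[of a b c] T_subset
  by (auto simp: zero_extension_def)

lemma zero_extension_right_bracketing:
  assumes "z \<notin> S" and "a \<in> S" "b \<in> S" "c \<in> S"
  shows "zero_extension T f z a (zero_extension T f z b c) =
    (if (a, b) \<in> T \<and> (b, c) \<in> T then f a (f b c) else z)"
  using assms locality_right[of a b c] T_subset
  by (auto simp: zero_extension_def)

lemma zero_extension_assoc:
  assumes "z \<notin> S" and "a \<in> S \<union> {z}" "b \<in> S \<union> {z}" "c \<in> S \<union> {z}"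
  shows "zero_extension T f z (zero_extension T f z a b) c =
    zero_extension T f z a (zero_extension T f z b c)"
proof (cases "a = z \<or> b = z \<or> c = z")
  case True
  then show ?thesis
    using zero_extension_zero[OF assms(1)] by auto
next
  case False
  then have "a \<in> S" "b \<in> S" "c \<in> S"
    using assms by auto
  then show ?thesis
    using assms(1) locality_assoc
    by (simp add: zero_extension_left_bracketing zero_extension_right_bracketing)
qed

end

theorem theorem4p1:
  fixes S :: "'a set" and T :: "('a \<times> 'a) set" and f :: "'a \<Rightarrow> 'a \<Rightarrow> 'a" and z :: 'a
  assumes "refined_locality_semigroup S T f"
    and "z \<notin> S"
  shows "semigroup_with_zero_on (S \<union> {z}) (zero_extension T f z) z"
proof -
  interpret refined_locality_semigroup S T f
    by (fact assms(1))
  show ?thesis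
  proof
    show "zero_extension T f z x y \<in> S \<union> {z}" for x y
      using closed by (simp add: zero_extension_def)
  qed (use zero_extension_assoc zero_extension_zero assms(2) in auto)
qed

end
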